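(* Let $\tau$ be a triangle function on $\Delta^+$, let $\Sigma$ be a ring of subsets of a set $\Omega\neq\emptyset$, and let $\gamma:\Sigma\to\Delta^+$ be a $\tau$-decomposable antimonotone submeasure. Define the mapping $\rho:\Sigma\times\Sigma\to\Delta^+$ by $\rho_{E,F}:=\gamma_{E\triangle F}$ for $E,F\in\Sigma$. Then the triple $(\Sigma,\rho,\tau)$ is a PpM-space (under $\tau$).
   Context: $\Delta^+$ is the set of distance distribution functions: all $F:[-\infty,+\infty]\to[0,1]$ that are non-decreasing, left-continuous on $\mathbb{R}$, with $F(-\infty)=0$, $F(0)=0$ and $F(+\infty)=1$. It is ordered pointwise: $G\leq H$ iff $G(x)\leq H(x)$ for all $x$. The element $\varepsilon_0\in\Delta^+$ is given by $\varepsilon_0(x)=1$ for $x>0$ and $\varepsilon_0(x)=0$ otherwise. A triangle function is a mapping $\tau:\Delta^+\times\Delta^+\to\Delta^+$ that is symmetric, associative, non-decreasing in each variable, and has $\varepsilon_0$ as identity. For $\gamma:\Sigma\to\Delta^+$ write $\gamma_E$ for $\gamma(E)$. Such $\gamma$ is a $\tau$-decomposable submeasure if $\gamma_\emptyset=\varepsilon_0$ and $\gamma_{E\cup F}\geq\tau(\gamma_E,\gamma_F)$ for all disjoint $E,F\in\Sigma$; it is antimonotone if $\gamma_E\geq\gamma_F$ whenever $E\subseteq F$ in $\Sigma$. $\triangle$ is symmetric difference. A probabilistic pseudo-metric space (PpM-space) is a triple $(X,\rho,\tau)$ with $X$ a non-empty set, $\tau$ a triangle function and $\rho:X\times X\to\Delta^+$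 such that for all $p,q,r\in X$: $\rho_{p,p}=\varepsilon_0$; $\rho_{p,q}=\rho_{q,p}$; $\rho_{p,r}\geq\tau(\rho_{p,q},\rho_{q,r})$. *)

theory Defs
  imports "HOL-Analysis.Analysis"
begin

text \<open>
  Distance distribution functions are the members of a set of functions
  \<^typ>\<open>ereal \<Rightarrow> real\<close>; the library's order on functions is then the pointwise order.
  Left-continuity is required at the finite points only.
\<close>

definition distance_dfs :: "(ereal \<Rightarrow> real) set" (\<open>\<Delta>\<^sup>+\<close>)
  where "\<Delta>\<^sup>+ =
    {F. (\<forall>x. F x \<in> {0..1}) \<and> mono F \<and> (\<forall>x::real. continuous (at_left (ereal x)) F) \<and>
        F (-\<infinity>) = 0 \<and> F 0 = 0 \<and> F \<infinity> = 1}"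

definition \<epsilon>\<^sub>0 :: "ereal \<Rightarrow> real"
  where "\<epsilon>\<^sub>0 x = (if x > 0 then 1 else 0)"

lemma eps_0_in_distance_dfs: "\<epsilon>\<^sub>0 \<in> \<Delta>\<^sup>+"
proof -
  have "continuous (at_left (ereal x)) \<epsilon>\<^sub>0" for x :: real
  proof (cases "x > 0")
    case True
    have "\<forall>\<^sub>F t in at_left (ereal x). t \<in> {0<..<ereal x}"
      using True by (intro eventually_at_leftI[of 0]) auto
    then have "\<forall>\<^sub>F t in at_left (ereal x). \<epsilon>\<^sub>0 t = \<epsilon>\<^sub>0 (ereal x)"
      using True by (auto simp: \<epsilon>\<^sub>0_def elim!: eventually_mono)
    then show ?thesis
      unfolding continuous_within by (rule tendsto_eventually)
  next
    case False
    have "\<forall>\<^sub>F t in at_left (ereal x). t \<in> {-\<infinity><..<ereal x}"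
      by (intro eventually_at_leftI[of "-\<infinity>"]) auto
    then have "\<forall>\<^sub>F t in at_left (ereal x). \<epsilon>\<^sub>0 t = \<epsilon>\<^sub>0 (ereal x)"
      using False by (elim eventually_mono) (auto simp: \<epsilon>\<^sub>0_def dest: less_trans)
    then show ?thesis
      unfolding continuous_within by (rule tendsto_eventually)
  qed
  then show ?thesis
    by (auto simp: distance_dfs_def \<epsilon>\<^sub>0_def mono_def)
qed

locale triangle_function =
  fixes \<tau> :: "(ereal \<Rightarrow> real) \<Rightarrow> (ereal \<Rightarrow> real) \<Rightarrow> (ereal \<Rightarrow> real)"
  assumes closed: "F \<in> \<Delta>\<^sup>+ \<Longrightarrow> G \<in> \<Delta>\<^sup>+ \<Longrightarrow> \<tau> F G \<in> \<Delta>\<^sup>+"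
    and commute: "F \<in> \<Delta>\<^sup>+ \<Longrightarrow> G \<in> \<Delta>\<^sup>+ \<Longrightarrow> \<tau> F G = \<tau> G F"
    and assoc: "F \<in> \<Delta>\<^sup>+ \<Longrightarrow> G \<in> \<Delta>\<^sup>+ \<Longrightarrow> H \<in> \<Delta>\<^sup>+ \<Longrightarrow> \<tau> (\<tau> F G) H = \<tau> F (\<tau> G H)"
    and mono_left: "F \<in> \<Delta>\<^sup>+ \<Longrightarrow> G \<in> \<Delta>\<^sup>+ \<Longrightarrow> H \<in> \<Delta>\<^sup>+ \<Longrightarrow> F \<le> G \<Longrightarrow> \<tau> F H \<le> \<tau> G H"
    and mono_right: "F \<in> \<Delta>\<^sup>+ \<Longrightarrow> G \<in> \<Delta>\<^sup>+ \<Longrightarrow> H \<in> \<Delta>\<^sup>+ \<Longrightarrow> F \<le> G \<Longrightarrow> \<tau> H F \<le> \<tau> H G"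
    and left_identity: "F \<in> \<Delta>\<^sup>+ \<Longrightarrow> \<tau> \<epsilon>\<^sub>0 F = F"
    and right_identity: "F \<in> \<Delta>\<^sup>+ \<Longrightarrow> \<tau> F \<epsilon>\<^sub>0 = F"

definition decomposable_submeasure ::
    "((ereal \<Rightarrow> real) \<Rightarrow> (ereal \<Rightarrow> real) \<Rightarrow> (ereal \<Rightarrow> real)) \<Rightarrow> 'a set set \<Rightarrow>
      ('a set \<Rightarrow> (ereal \<Rightarrow> real)) \<Rightarrow> bool"
  where "decomposable_submeasure \<tau> \<Sigma> \<gamma> \<longleftrightarrow>
    \<gamma> \<in> \<Sigma> \<rightarrow> \<Delta>\<^sup>+ \<and> \<gamma> {} = \<epsilon>\<^sub>0 \<and>
    (\<forall>E\<in>\<Sigma>. \<forall>F\<in>\<Sigma>. E \<inter> F = {} \<longrightarrow> \<gamma> (E \<union> F) \<ge> \<tau> (\<gamma> E) (\<gamma> F))"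

definition antimonotone_on :: "'a set set \<Rightarrow> ('a set \<Rightarrow> (ereal \<Rightarrow> real)) \<Rightarrow> bool"
  where "antimonotone_on \<Sigma> \<gamma> \<longleftrightarrow> (\<forall>E\<in>\<Sigma>. \<forall>F\<in>\<Sigma>. E \<subseteq> F \<longrightarrow> \<gamma> E \<ge> \<gamma> F)"

locale PpM_space = triangle_function \<tau>
  for X :: "'x set"
    and \<rho> :: "'x \<Rightarrow> 'x \<Rightarrow> (ereal \<Rightarrow> real)"
    and \<tau> :: "(ereal \<Rightarrow> real) \<Rightarrow> (ereal \<Rightarrow> real) \<Rightarrow> (ereal \<Rightarrow> real)" +
  assumes nonempty: "X \<noteq> {}"
    and dist_in: "p \<in> X \<Longrightarrow> q \<in> X \<Longrightarrow> \<rho> p q \<in> \<Delta>\<^sup>+"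
    and dist_refl: "p \<in> X \<Longrightarrow> \<rho> p p = \<epsilon>\<^sub>0"
    and dist_commute: "p \<in> X \<Longrightarrow> q \<in> X \<Longrightarrow> \<rho> p q = \<rho> q p"
    and dist_triangle: "p \<in> X \<Longrightarrow> q \<in> X \<Longrightarrow> r \<in> X \<Longrightarrow> \<rho> p r \<ge> \<tau> (\<rho> p q) (\<rho> q r)"

end

theory Submission
  imports Defs
begin

text \<open>
  The triangle inequality reduces to subadditivity along the cover
  \<open>E \<triangle> G \<subseteq> (E \<triangle> F) \<union> (F \<triangle> G)\<close>. Subadditivity for
  non-disjoint sets follows by writing \<open>A \<union> B\<close> as the disjoint union of \<open>A\<close> and \<open>B - A\<close>:
  antimonotonicity gives \<open>\<gamma> (B - A) \<ge> \<gamma> B\<close>, and \<open>\<tau>\<close> is monotone.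
\<close>

lemma (in triangle_function) decomposable_submeasure_Un:
  assumes "ring_of_sets \<Omega> \<Sigma>" "decomposable_submeasure \<tau> \<Sigma> \<gamma>" "antimonotone_on \<Sigma> \<gamma>"
    and A: "A \<in> \<Sigma>" and B: "B \<in> \<Sigma>"
  shows "\<tau> (\<gamma> A) (\<gamma> B) \<le> \<gamma> (A \<union> B)"
proof -
  interpret ring_of_sets \<Omega> \<Sigma> by fact
  have BA: "B - A \<in> \<Sigma>"
    using A B by blast
  have in_\<Delta>: "\<gamma> E \<in> \<Delta>\<^sup>+" if "E \<in> \<Sigma>" for E
    using assms(2) that by (auto simp: decomposable_submeasure_def)
  have "\<gamma> B \<le> \<gamma> (B - A)"
    using assms(3) B BA by (auto simp: antimonotone_on_def)
  then have "\<tau> (\<gamma> A) (\<gamma> B) \<le> \<tau> (\<gamma> A) (\<gamma> (B - A))"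
    using A B BA by (intro mono_right in_\<Delta>)
  \<comment> \<open>Decomposability applies here because \<open>A\<close> and \<open>B - A\<close>
    are disjoint.\<close>
  also have "\<dots> \<le> \<gamma> (A \<union> (B - A))"
    using assms(2) A BA unfolding decomposable_submeasure_def by blast
  finally show ?thesis by simp
qed

theorem theorem4p6:
  fixes \<tau> :: "(ereal \<Rightarrow> real) \<Rightarrow> (ereal \<Rightarrow> real) \<Rightarrow> (ereal \<Rightarrow> real)"
    and \<Omega> :: "'a set"
    and \<Sigma> :: "'a set set"
    and \<gamma> :: "'a set \<Rightarrow> (ereal \<Rightarrow> real)"
  assumes "triangle_function \<tau>"
    and "\<Omega> \<noteq> {}"
    and "ring_of_sets \<Omega> \<Sigma>"
    and "decomposable_submeasure \<tau> \<Sigma> \<gamma>"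
    and "antimonotone_on \<Sigma> \<gamma>"
  shows "PpM_space \<Sigma> (\<lambda>E F. \<gamma> (sym_diff E F)) \<tau>"
proof -
  interpret triangle_function \<tau> by fact
  interpret ring_of_sets \<Omega> \<Sigma> by fact
  have sym_diff_in: "sym_diff E F \<in> \<Sigma>" if "E \<in> \<Sigma>" "F \<in> \<Sigma>" for E F
    using that by blast
  show ?thesis
  proof
    show "\<Sigma> \<noteq> {}"
      using empty_sets by blast
  next
    fix E F assume "E \<in> \<Sigma>" "F \<in> \<Sigma>"
    then show "\<gamma> (sym_diff E F) \<in> \<Delta>\<^sup>+"
      using assms(4) sym_diff_in unfolding decomposable_submeasure_def by blast
  next
    fix E assume "E \<in> \<Sigma>"
    \<comment> \<open>The set is empty, so this is the normalisation of \<open>\<gamma>\<close> at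
      \<open>{}\<close>.\<close>
    show "\<gamma> (sym_diff E E) = \<epsilon>\<^sub>0"
      using assms(4) by (simp add: decomposable_submeasure_def)
  next
    fix E F assume "E \<in> \<Sigma>" "F \<in> \<Sigma>"
    show "\<gamma> (sym_diff E F) = \<gamma> (sym_diff F E)"
      by (simp add: Un_commute)
  next
    fix E F G assume EFG: "E \<in> \<Sigma>" "F \<in> \<Sigma>" "G \<in> \<Sigma>"
    \<comment> \<open>The two differences may overlap, in \<open>F - (E \<union> G)\<close> and in
      \<open>(E \<inter> G) - F\<close>, so decomposability alone does not suffice.\<close>
    have "\<tau> (\<gamma> (sym_diff E F)) (\<gamma> (sym_diff F G)) \<le> \<gamma> (sym_diff E F \<union> sym_diff F G)"
      using EFG by (intro decomposable_submeasure_Un[OF assms(3-5)] sym_diff_in)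
    also have "\<dots> \<le> \<gamma> (sym_diff E G)"
    proof -
      have "sym_diff E F \<union> sym_diff F G \<in> \<Sigma>"
        using EFG by (intro Un sym_diff_in)
      \<comment> \<open>A point lying in exactly one of \<open>E\<close> and \<open>G\<close> is,
        whether in \<open>F\<close> or not, separated from \<open>F\<close> by one of them. Passing
        to the smaller set can only raise \<open>\<gamma>\<close>.\<close>
      moreover have "sym_diff E G \<subseteq> sym_diff E F \<union> sym_diff F G"
        by blast
      ultimately show ?thesis
        using assms(5) sym_diff_in[OF EFG(1,3)] unfolding antimonotone_on_def by blast
    qed
    finally show "\<tau> (\<gamma> (sym_diff E F)) (\<gamma> (sym_diff F G)) \<le> \<gamma> (sym_diff E G)" .
  qed
qed

end
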